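(* Let $(X,\Omega)$ and $(Y,\Xi)$ be measurable spaces, let $\nu_1$ be a finite measure on $(X,\Omega)$, and let $\{\mu^x\}_{x\in X}$ be a family of probability measures on $(Y,\Xi)$ such that for every $E\in\Xi$ the function $x\mapsto\mu^x(E)$ is $\Omega$-measurable. Let $\nu_2$ be the (finite) measure on $(Y,\Xi)$ given by $$\nu_2(E)=\int_X\mu^x(E)\,\nu_1(dx),\qquad E\in\Xi.$$ Then for any $1\le p\le\infty$, the map $A$ given by $$(Af)(x)=\int_Y f(y)\,\mu^x(dy)$$ is a well-defined map from $L^p(Y,\nu_2)$ into the space of equivalence classes of $\nu_1$-almost everywhere equal functions on $X$: given an equivalence class in $L^p(Y,\nu_2)$, the integral converges for $\nu_1$-almost every $x$, and its value is independent of the choice of representative up to a set of $\nu_1$-measure zero. Furthermore, $$\|Af\|_{L^p(X,\nu_1)}\le\|f\|_{L^p(Y,\nu_2)},$$ so $A$ is a contraction of $L^p(Y,\nu_2)$ into $L^p(X,\nu_1)$.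
   Context: Functions are complex-valued (or real-valued). A family $\{\mu^x\}_{x\in X}$ as in the statement is called a Markov kernel. *)

theory Defs
  imports "HOL-Probability.Probability"
begin

text \<open>
  The scalars are an arbitrary second countable complete normed field; the instances that
  matter are \<open>real\<close> and \<open>complex\<close>.
\<close>

definition markov_kernel :: "'a measure \<Rightarrow> 'b measure \<Rightarrow> ('a \<Rightarrow> 'b measure) \<Rightarrow> bool" where
  "markov_kernel X Y \<mu> \<longleftrightarrow>
     (\<forall>x\<in>space X. prob_space (\<mu> x) \<and> sets (\<mu> x) = sets Y) \<and>
     (\<forall>E\<in>sets Y. (\<lambda>x. measure (\<mu> x) E) \<in> borel_measurable X)"

definition kernel_mixture :: "'a measure \<Rightarrow> 'b measure \<Rightarrow> ('a \<Rightarrow> 'b measure) \<Rightarrow> 'b measure" where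
  "kernel_mixture \<nu> Y \<mu> =
     measure_of (space Y) (sets Y) (\<lambda>E. \<integral>\<^sup>+x. emeasure (\<mu> x) E \<partial>\<nu>)"

text \<open>
  Classes of almost everywhere equal functions, and the Lebesgue spaces as sets of such classes.
  The representatives are measurable functions on the whole type; their values outside
  \<open>space M\<close> are irrelevant.
\<close>

definition ae_class ::
    "'a measure \<Rightarrow> ('a \<Rightarrow> 'c::topological_space) \<Rightarrow> ('a \<Rightarrow> 'c) set" where
  "ae_class M f = {g \<in> borel_measurable M. AE x in M. g x = f x}"

definition ae_classes :: "'a measure \<Rightarrow> ('a \<Rightarrow> 'c::topological_space) set set" where
  "ae_classes M = ae_class M ` borel_measurable M"

definition ae_lincomb ::
    "'a measure \<Rightarrow> 'c \<Rightarrow> ('a \<Rightarrow> 'c) set \<Rightarrow> 'c \<Rightarrow> ('a \<Rightarrow> 'c) set \<Rightarrow> ('a \<Rightarrow> 'c::real_normed_field) set"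
  where
  "ae_lincomb M a F b G = (\<Union>f\<in>F. \<Union>g\<in>G. ae_class M (\<lambda>x. a * f x + b * g x))"

definition Lp_functions ::
    "'a measure \<Rightarrow> ennreal \<Rightarrow> ('a \<Rightarrow> 'c::real_normed_vector) set" where
  "Lp_functions M p = {f \<in> borel_measurable M.
     if p = \<infinity> then esssup M (\<lambda>x. ennreal (norm (f x))) < \<infinity>
     else integrable M (\<lambda>x. norm (f x) powr enn2real p)}"

text \<open>Only meaningful for members of \<open>Lp_functions M p\<close>.\<close>

definition Lp_norm :: "'a measure \<Rightarrow> ennreal \<Rightarrow> ('a \<Rightarrow> 'c::real_normed_vector) \<Rightarrow> real" where
  "Lp_norm M p f =
     (if p = \<infinity> then enn2real (esssup M (\<lambda>x. ennreal (norm (f x))))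
      else (\<integral>x. norm (f x) powr enn2real p \<partial>M) powr (1 / enn2real p))"

definition Lp_space ::
    "'a measure \<Rightarrow> ennreal \<Rightarrow> ('a \<Rightarrow> 'c::real_normed_vector) set set" where
  "Lp_space M p = ae_class M ` Lp_functions M p"

text \<open>The norm of a class is the common value of \<open>Lp_norm\<close> on its representatives.\<close>

definition Lp_class_norm ::
    "'a measure \<Rightarrow> ennreal \<Rightarrow> ('a \<Rightarrow> 'c::real_normed_vector) set \<Rightarrow> real" where
  "Lp_class_norm M p F = the_elem (Lp_norm M p ` F)"

lemma Lp_norm_cong_AE:
  fixes f g :: "'a \<Rightarrow> 'c::real_normed_vector"
  assumes [measurable]: "f \<in> borel_measurable M" "g \<in> borel_measurable M"
    and eq: "AE x in M. f x = g x"
  shows "Lp_norm M p f = Lp_norm M p g"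
proof -
  have "esssup M (\<lambda>x. ennreal (norm (f x))) = esssup M (\<lambda>x. ennreal (norm (g x)))"
    by (rule esssup_AE_cong) (use eq in auto)
  moreover have "(\<integral>x. norm (f x) powr enn2real p \<partial>M) = (\<integral>x. norm (g x) powr enn2real p \<partial>M)"
    by (rule integral_cong_AE) (use eq in auto)
  ultimately show ?thesis
    unfolding Lp_norm_def by simp
qed

lemma Lp_class_norm_ae_class:
  fixes f :: "'a \<Rightarrow> 'c::real_normed_vector"
  assumes "f \<in> borel_measurable M"
  shows "Lp_class_norm M p (ae_class M f) = Lp_norm M p f"
proof -
  have "Lp_norm M p g = Lp_norm M p f" if "g \<in> ae_class M f" for g
    using that assms by (intro Lp_norm_cong_AE) (auto simp: ae_class_def)
  moreover have "f \<in> ae_class M f"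
    using assms by (simp add: ae_class_def)
  ultimately have "Lp_norm M p ` ae_class M f = {Lp_norm M p f}"
    by blast
  then show ?thesis
    by (simp add: Lp_class_norm_def)
qed

text \<open>
  The Bochner integral is \<open>0\<close> where it does not converge, so \<open>kernel_integral\<close> is total.
  That convention cannot affect \<open>kernel_operator\<close> on classes whose representatives are
  integrable for almost every \<open>x\<close>.
\<close>

definition kernel_integral ::
    "('a \<Rightarrow> 'b measure) \<Rightarrow> ('b \<Rightarrow> 'c::{banach, second_countable_topology}) \<Rightarrow> 'a \<Rightarrow> 'c" where
  "kernel_integral \<mu> f x = (\<integral>y. f y \<partial>\<mu> x)"

definition kernel_operator ::
    "'a measure \<Rightarrow> ('a \<Rightarrow> 'b measure) \<Rightarrow>
     ('b \<Rightarrow> 'c::{banach, second_countable_topology}) set \<Rightarrow> ('a \<Rightarrow> 'c) set" where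
  "kernel_operator \<nu> \<mu> F = (\<Union>f\<in>F. ae_class \<nu> (kernel_integral \<mu> f))"

end

theory Submission
  imports Defs
begin

text \<open>
  Fubini for the mixture, \<open>\<integral> f d\<nu>\<^sub>2 = \<integral>\<integral> f d\<mu>\<^sup>x \<nu>\<^sub>1(dx)\<close> for \<open>f \<ge> 0\<close>, transfers null sets and
  integrability from \<open>\<nu>\<^sub>2\<close> to \<open>\<mu>\<^sup>x\<close> for almost every \<open>x\<close>. The contraction estimate is then
  Jensen's inequality \<open>\<bar>\<integral> f d\<mu>\<^sup>x\<bar>\<^sup>p \<le> \<integral> \<bar>f\<bar>\<^sup>p d\<mu>\<^sup>x\<close> for almost every \<open>x\<close>, integrated against \<open>\<nu>\<^sub>1\<close>; for
  \<open>p = \<infinity>\<close> it is the bound of \<open>f\<close> by its essential supremum, which holds \<open>\<mu>\<^sup>x\<close>-almost everywhere.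
\<close>

section \<open>Jensen's inequality for powers of the norm\<close>

text \<open>A convex function lies above its tangents; here the tangent to \<open>s powr r\<close>
  at \<open>s = 1\<close>.\<close>

lemma Bernoulli_powr:
  fixes r s :: real
  assumes "1 \<le> r" "0 \<le> s"
  shows "1 + r * (s - 1) \<le> s powr r"
proof (cases "s = 0")
  \<comment> \<open>The point 0 lies outside the open half-line on which convexity is used; the
    claim there is \<open>1 - r \<le> 0\<close>.\<close>
  case True
  then show ?thesis using assms by simp
next
  case False
  have "((\<lambda>x. x powr r) has_real_derivative r * 1 powr (r - 1)) (at 1 within {0<..})"
    by (rule has_field_derivative_at_within, rule has_real_derivative_powr) simp
  then have "s powr r - 1 powr r \<ge> r * 1 powr (r - 1) * (s - 1)"
    using assms False
    by (intro convex_on_imp_above_tangent[OF powr_convex[OF assms(1)]])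
       (auto simp: interior_open)
  then show ?thesis by simp
qed

text \<open>Dividing \<open>norm (f x)\<close> by its mean \<open>m\<close> reduces Jensen's
  inequality to the tangent bound at 1, which is then integrated.\<close>

lemma (in prob_space) norm_integral_powr_le:
  fixes f :: "'a \<Rightarrow> 'b::{banach, second_countable_topology}"
  assumes "1 \<le> r" and f: "integrable M f" and fr: "integrable M (\<lambda>x. norm (f x) powr r)"
  shows "norm (\<integral>x. f x \<partial>M) powr r \<le> (\<integral>x. norm (f x) powr r \<partial>M)"
proof -
  define m where "m = (\<integral>x. norm (f x) \<partial>M)"
  have m: "norm (\<integral>x. f x \<partial>M) \<le> m"
    unfolding m_def by (rule integral_norm_bound)
  have int: "integrable M (\<lambda>x. norm (f x))"
    using f by (rule integrable_norm)
  have "m powr r \<le> (\<integral>x. norm (f x) powr r \<partial>M)"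
  proof (cases "m > 0")
    case True
    \<comment> \<open>The factor \<open>norm (f x) / m - 1\<close> has integral 0 by the choice of
      \<open>m\<close>, and the total mass is 1.\<close>
    have "1 = (\<integral>x. 1 + r * (norm (f x) / m - 1) \<partial>M)"
      using int True by (simp add: prob_space flip: m_def)
    also have "\<dots> \<le> (\<integral>x. norm (f x) powr r / m powr r \<partial>M)"
    proof (rule integral_mono)
      show "1 + r * (norm (f x) / m - 1) \<le> norm (f x) powr r / m powr r" for x
        using Bernoulli_powr[OF \<open>1 \<le> r\<close>, of "norm (f x) / m"] True by (simp add: powr_divide)
    qed (use int fr in auto)
    finally show ?thesis
      using True by (simp add: field_simps)
  next
    case False
    then have "m = 0"
      using m norm_ge_zero[of "\<integral>x. f x \<partial>M"] by linarith
    then show ?thesis by simp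
  qed
  moreover have "norm (\<integral>x. f x \<partial>M) powr r \<le> m powr r"
    using m assms(1) by (intro powr_mono2) auto
  ultimately show ?thesis by simp
qed

section \<open>Lebesgue spaces over a finite measure and classes of functions\<close>

text \<open>Constants are integrable, so a bounded function is integrable, and for finite
  \<open>p\<close> the function \<open>1 + norm (f x) powr r\<close> is an integrable majorant. Thus
  every exponent reduces to the case of integrable \<open>f\<close> when convergence of the kernel
  integrals is at stake.\<close>

lemma (in finite_measure) integrable_Lp_functions:
  fixes f :: "'a \<Rightarrow> 'b::{banach, second_countable_topology}"
  assumes f: "f \<in> Lp_functions M p" and "1 \<le> p"
  shows "integrable M f"
proof (cases "p = \<infinity>")
  case True
  have [measurable]: "f \<in> borel_measurable M"
    using f by (simp add: Lp_functions_def)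
  define c where "c = esssup M (\<lambda>x. ennreal (norm (f x)))"
  have "c < \<infinity>"
    using f True by (simp add: Lp_functions_def c_def)
  moreover have "AE x in M. ennreal (norm (f x)) \<le> c"
    unfolding c_def by (rule esssup_AE)
  ultimately have "AE x in M. norm (f x) \<le> enn2real c"
    by (auto elim!: eventually_mono dest!: enn2real_mono)
  then show ?thesis
    by (intro integrable_const_bound) auto
next
  case False
  define r where "r = enn2real p"
  have "1 \<le> r"
    using \<open>1 \<le> p\<close> False unfolding r_def by (cases p) auto
  have [measurable]: "f \<in> borel_measurable M" and int: "integrable M (\<lambda>x. norm (f x) powr r)"
    using f False by (auto simp: Lp_functions_def r_def)
  have bound: "norm (f x) \<le> 1 + norm (f x) powr r" for x
  proof (cases "norm (f x) \<le> 1")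
    case True
    then show ?thesis by (simp add: add_increasing2)
  next
    case False
    then have "norm (f x) powr 1 \<le> norm (f x) powr r"
      using \<open>1 \<le> r\<close> by (intro powr_mono) auto
    then show ?thesis using False by simp
  qed
  show ?thesis
  proof (rule Bochner_Integration.integrable_bound)
    show "integrable M (\<lambda>x. 1 + norm (f x) powr r)"
      using int by auto
    show "AE x in M. norm (f x) \<le> norm (1 + norm (f x) powr r)"
      using bound by (auto intro: order_trans[OF _ abs_ge_self])
  qed auto
qed

text \<open>Members of an \<open>ae_class\<close> are only known to be measurable; this gives all of
  them the integrability properties of the chosen representative.\<close>

lemma Lp_functions_cong_AE:
  fixes f g :: "'a \<Rightarrow> 'b::{banach, second_countable_topology}"
  assumes f: "f \<in> Lp_functions M p" and [measurable]: "g \<in> borel_measurable M"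
    and eq: "AE x in M. g x = f x"
  shows "g \<in> Lp_functions M p"
proof -
  have [measurable]: "f \<in> borel_measurable M"
    using f by (simp add: Lp_functions_def)
  have "esssup M (\<lambda>x. ennreal (norm (g x))) = esssup M (\<lambda>x. ennreal (norm (f x)))"
    by (rule esssup_AE_cong) (use eq in auto)
  moreover have "integrable M (\<lambda>x. norm (g x) powr enn2real p) \<longleftrightarrow>
      integrable M (\<lambda>x. norm (f x) powr enn2real p)"
    by (rule integrable_cong_AE) (use eq in auto)
  ultimately show ?thesis
    using f by (auto simp: Lp_functions_def split: if_splits)
qed

lemma ae_class_eqI:
  assumes "AE x in M. f x = g x"
  shows "ae_class M f = ae_class M g"
  using assms unfolding ae_class_def by (auto elim: eventually_elim2)

text \<open>All classes in the union defining \<open>ae_lincomb\<close> coincide, and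
  \<open>f\<close> and \<open>g\<close> themselves show that the union is not empty.\<close>

lemma ae_lincomb_ae_class:
  fixes f g :: "'a \<Rightarrow> 'b::real_normed_field"
  assumes f: "f \<in> borel_measurable M" and g: "g \<in> borel_measurable M"
  shows "ae_lincomb M a (ae_class M f) b (ae_class M g) = ae_class M (\<lambda>x. a * f x + b * g x)"
proof -
  have "ae_class M (\<lambda>x. a * f' x + b * g' x) = ae_class M (\<lambda>x. a * f x + b * g x)"
    if "f' \<in> ae_class M f" "g' \<in> ae_class M g" for f' g'
    using that by (intro ae_class_eqI) (auto simp: ae_class_def elim: eventually_elim2)
  moreover have "f \<in> ae_class M f" "g \<in> ae_class M g"
    using f g by (simp_all add: ae_class_def)
  ultimately show ?thesis
    unfolding ae_lincomb_def by blast
qed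

section \<open>The mixture measure and almost everywhere transfer to the kernel\<close>

locale markov_mixture = finite_measure \<nu>
  for \<nu> :: "'a measure" and Y :: "'b measure" and \<mu> :: "'a \<Rightarrow> 'b measure" +
  assumes kernel: "markov_kernel \<nu> Y \<mu>"
begin

abbreviation mixture :: "'b measure"
  where "mixture \<equiv> kernel_mixture \<nu> Y \<mu>"

lemma prob_space_kernel: "x \<in> space \<nu> \<Longrightarrow> prob_space (\<mu> x)"
  and sets_kernel_eq: "x \<in> space \<nu> \<Longrightarrow> sets (\<mu> x) = sets Y"
  using kernel by (auto simp: markov_kernel_def)

text \<open>Measurability of \<open>\<mu>\<close> as a map into the space of subprobability measures
  is the form that \<open>bind\<close> and integrals depending on a parameter require. It is
  generated by the evaluations at sets, which are real-valued in \<open>markov_kernel\<close> and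
  are lifted here to \<open>ennreal\<close>.\<close>

lemma measurable_kernel [measurable]: "\<mu> \<in> measurable \<nu> (subprob_algebra Y)"
proof (rule measurable_subprob_algebra)
  fix E assume E: "E \<in> sets Y"
  have "(\<lambda>x. ennreal (measure (\<mu> x) E)) \<in> borel_measurable \<nu>"
    using kernel E by (auto simp: markov_kernel_def)
  moreover have "emeasure (\<mu> x) E = ennreal (measure (\<mu> x) E)" if "x \<in> space \<nu>" for x
  proof -
    interpret prob_space "\<mu> x" using that by (rule prob_space_kernel)
    show ?thesis by (rule emeasure_eq_measure)
  qed
  ultimately show "(\<lambda>x. emeasure (\<mu> x) E) \<in> borel_measurable \<nu>"
    by (simp cong: measurable_cong)
qed (simp_all add: prob_space_kernel prob_space_imp_subprob_space sets_kernel_eq)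

lemma sets_mixture [simp, measurable_cong]: "sets mixture = sets Y"
  by (simp add: kernel_mixture_def)

lemma borel_measurable_mixture [simp]: "borel_measurable mixture = borel_measurable Y"
  by (rule measurable_cong_sets) simp_all

lemma borel_measurable_kernel:
  "x \<in> space \<nu> \<Longrightarrow> f \<in> borel_measurable Y \<Longrightarrow> f \<in> borel_measurable (\<mu> x)"
  using measurable_cong_sets[OF sets_kernel_eq refl] by blast

text \<open>The library's \<open>bind\<close> forgets the target space when the source space is empty.\<close>

lemma mixture_eq:
  "mixture = (if space \<nu> = {} then null_measure Y else \<nu> \<bind> \<mu>)"
proof -
  define N where "N = (if space \<nu> = {} then null_measure Y else \<nu> \<bind> \<mu>)"
  have sets_N: "sets N = sets Y"
    using measurable_kernel by (auto simp: N_def intro!: sets_bind sets_kernel_eq)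
  have "emeasure N E = (\<integral>\<^sup>+x. emeasure (\<mu> x) E \<partial>\<nu>)" if "E \<in> sets Y" for E
    using that emeasure_bind[OF _ measurable_kernel that]
    by (simp add: N_def nn_integral_empty)
  \<comment> \<open>\<open>measure_of\<close> returns the given set function only if that is a
    measure; agreement with \<open>emeasure N\<close> supplies the countable additivity.\<close>
  then have "mixture = measure_of (space N) (sets N) (emeasure N)"
    unfolding kernel_mixture_def sets_N sets_eq_imp_space_eq[OF sets_N]
    by (intro measure_of_eq) (auto simp: sets.space_closed sets.sigma_sets_eq)
  then show ?thesis
    by (simp add: measure_of_of_measure N_def)
qed

text \<open>This is the integration formula for \<open>bind\<close>; over an empty source both sides
  are 0.\<close>

lemma nn_integral_mixture:
  assumes "f \<in> borel_measurable Y"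
  shows "(\<integral>\<^sup>+y. f y \<partial>mixture) = (\<integral>\<^sup>+x. \<integral>\<^sup>+y. f y \<partial>\<mu> x \<partial>\<nu>)"
  using nn_integral_bind[OF assms measurable_kernel] assms
  by (simp add: mixture_eq nn_integral_empty)

lemma emeasure_mixture:
  assumes "E \<in> sets Y"
  shows "emeasure mixture E = (\<integral>\<^sup>+x. emeasure (\<mu> x) E \<partial>\<nu>)"
proof -
  have "emeasure mixture E = (\<integral>\<^sup>+x. \<integral>\<^sup>+y. indicator E y \<partial>\<mu> x \<partial>\<nu>)"
    using assms by (simp flip: nn_integral_mixture)
  also have "\<dots> = (\<integral>\<^sup>+x. emeasure (\<mu> x) E \<partial>\<nu>)"
    using assms by (intro nn_integral_cong) (simp add: sets_kernel_eq)
  finally show ?thesis .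
qed

lemma finite_measure_mixture: "finite_measure mixture"
proof
  have "emeasure mixture (space Y) \<le> (\<integral>\<^sup>+x. 1 \<partial>\<nu>)"
    unfolding emeasure_mixture[OF sets.top]
    by (intro nn_integral_mono)
       (simp add: prob_space.measure_le_1 prob_space_kernel)
  also have "\<dots> < \<infinity>"
    by (simp flip: less_top)
  finally show "emeasure mixture (space mixture) \<noteq> \<infinity>"
    by (simp add: sets_eq_imp_space_eq[OF sets_mixture])
qed

text \<open>If the mixture vanishes on \<open>N\<close>, then the nonnegative function
  \<open>emeasure (\<mu> x) N\<close> of \<open>x\<close> has integral 0, hence is 0 almost
  everywhere.\<close>

lemma AE_mixtureD:
  assumes "AE y in mixture. P y"
  shows "AE x in \<nu>. AE y in \<mu> x. P y"
proof -
  \<comment> \<open>The exceptional set of \<open>P\<close> may fail to be measurable, so a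
    measurable null set covering it is used.\<close>
  obtain N where N: "{y \<in> space mixture. \<not> P y} \<subseteq> N" "N \<in> sets Y" "emeasure mixture N = 0"
    using assms by (auto elim!: AE_E)
  have "(\<integral>\<^sup>+x. emeasure (\<mu> x) N \<partial>\<nu>) = 0"
    using N by (simp flip: emeasure_mixture)
  moreover have "(\<lambda>x. emeasure (\<mu> x) N) \<in> borel_measurable \<nu>"
    using N(2) by measurable
  ultimately have "AE x in \<nu>. emeasure (\<mu> x) N = 0"
    by (simp add: nn_integral_0_iff_AE)
  then show ?thesis
    using AE_space
  proof eventually_elim
    case (elim x)
    then show ?case
      using N sets_eq_imp_space_eq[OF sets_kernel_eq] sets_eq_imp_space_eq[OF sets_mixture]
      by (intro AE_I[where N=N]) (auto simp: sets_kernel_eq)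
  qed
qed

text \<open>The iterated integral of the norm is finite, so its inner integral is finite for almost
  every \<open>x\<close>.\<close>

lemma AE_integrable_kernel:
  fixes f :: "'b \<Rightarrow> 'c::{banach, second_countable_topology}"
  assumes f: "integrable mixture f"
  shows "AE x in \<nu>. integrable (\<mu> x) f"
proof -
  have f_Y [measurable]: "f \<in> borel_measurable Y"
    using borel_measurable_integrable[OF f] by simp
  have "(\<integral>\<^sup>+x. \<integral>\<^sup>+y. norm (f y) \<partial>\<mu> x \<partial>\<nu>) < \<infinity>"
    using f by (simp add: integrable_iff_bounded flip: nn_integral_mixture)
  then have "AE x in \<nu>. (\<integral>\<^sup>+y. norm (f y) \<partial>\<mu> x) \<noteq> \<infinity>"
    by (intro nn_integral_PInf_AE) auto
  then show ?thesis
    using AE_space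
    by eventually_elim (auto simp: integrable_iff_bounded less_top borel_measurable_kernel)
qed

section \<open>The kernel integral on functions and on classes\<close>

text \<open>This covers also the points where the integral diverges and has the default value 0, so
  that \<open>kernel_integral \<mu> f\<close> belongs to its own \<open>ae_class\<close>.\<close>

lemma borel_measurable_kernel_integral [measurable]:
  fixes f :: "'b \<Rightarrow> 'c::{banach, second_countable_topology}"
  assumes [measurable]: "f \<in> borel_measurable Y"
  shows "kernel_integral \<mu> f \<in> borel_measurable \<nu>"
  unfolding kernel_integral_def by measurable

lemma kernel_integral_cong_AE:
  fixes f g :: "'b \<Rightarrow> 'c::{banach, second_countable_topology}"
  assumes f: "f \<in> borel_measurable Y" and g: "g \<in> borel_measurable Y"
    and "AE y in mixture. f y = g y"
  shows "AE x in \<nu>. kernel_integral \<mu> f x = kernel_integral \<mu> g x"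
  using AE_mixtureD[OF assms(3)] AE_space
  by eventually_elim
     (auto simp: kernel_integral_def intro!: integral_cong_AE borel_measurable_kernel f g)

text \<open>Equivalent representatives have almost everywhere equal kernel integrals, so the union
  defining \<open>kernel_operator\<close> collapses to a single class.\<close>

lemma kernel_operator_ae_class:
  fixes f :: "'b \<Rightarrow> 'c::{banach, second_countable_topology}"
  assumes f: "f \<in> borel_measurable Y"
  shows "kernel_operator \<nu> \<mu> (ae_class mixture f) = ae_class \<nu> (kernel_integral \<mu> f)"
proof -
  have "ae_class \<nu> (kernel_integral \<mu> g) = ae_class \<nu> (kernel_integral \<mu> f)"
    if "g \<in> ae_class mixture f" for g
    using that f by (intro ae_class_eqI kernel_integral_cong_AE) (auto simp: ae_class_def)
  moreover have "f \<in> ae_class mixture f"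
    using f by (simp add: ae_class_def)
  ultimately show ?thesis
    unfolding kernel_operator_def by blast
qed

text \<open>Additivity can fail where one of the integrals takes its default value, which happens
  only on a null set.\<close>

lemma kernel_integral_lincomb:
  fixes f g :: "'b \<Rightarrow> 'c::{real_normed_field, banach, second_countable_topology}"
  assumes "integrable mixture f" "integrable mixture g"
  shows "AE x in \<nu>. kernel_integral \<mu> (\<lambda>y. a * f y + b * g y) x =
    a * kernel_integral \<mu> f x + b * kernel_integral \<mu> g x"
  using AE_integrable_kernel[OF assms(1)] AE_integrable_kernel[OF assms(2)]
  by eventually_elim (simp add: kernel_integral_def)

section \<open>The contraction estimate on functions\<close>

lemma kernel_integral_contraction_infinity:
  fixes f :: "'b \<Rightarrow> 'c::{banach, second_countable_topology}"
  assumes f: "f \<in> Lp_functions mixture \<infinity>"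
  shows "kernel_integral \<mu> f \<in> Lp_functions \<nu> \<infinity> \<and>
    Lp_norm \<nu> \<infinity> (kernel_integral \<mu> f) \<le> Lp_norm mixture \<infinity> f"
proof -
  interpret mix: finite_measure mixture by (rule finite_measure_mixture)
  have f_Y [measurable]: "f \<in> borel_measurable Y"
    using f by (simp add: Lp_functions_def)
  have int: "integrable mixture f"
    using f by (rule mix.integrable_Lp_functions) simp
  define c where "c = esssup mixture (\<lambda>y. ennreal (norm (f y)))"
  have "c < \<infinity>"
    using f by (simp add: Lp_functions_def c_def)
  have "AE y in mixture. ennreal (norm (f y)) \<le> c"
    unfolding c_def by (rule esssup_AE)
  from AE_mixtureD[OF this] AE_integrable_kernel[OF int] AE_space
  have "AE x in \<nu>. ennreal (norm (kernel_integral \<mu> f x)) \<le> c"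
  proof eventually_elim
    case (elim x)
    interpret prob_space "\<mu> x" using elim by (intro prob_space_kernel)
    have "ennreal (norm (kernel_integral \<mu> f x)) \<le> (\<integral>\<^sup>+y. norm (f y) \<partial>\<mu> x)"
      unfolding kernel_integral_def using elim by (intro integral_norm_bound_ennreal)
    also have "\<dots> \<le> (\<integral>\<^sup>+y. c \<partial>\<mu> x)"
      using elim by (intro nn_integral_mono_AE)
    \<comment> \<open>The total mass 1 of \<open>\<mu> x\<close> keeps the constant at
      \<open>c\<close>.\<close>
    also have "\<dots> = c"
      by (simp add: emeasure_space_1)
    finally show ?case .
  qed
  then have "esssup \<nu> (\<lambda>x. ennreal (norm (kernel_integral \<mu> f x))) \<le> c"
    by (intro esssup_I) auto
  then show ?thesis
    using \<open>c < \<infinity>\<close> by (auto simp: Lp_functions_def Lp_norm_def c_def intro: enn2real_mono)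
qed

lemma kernel_integral_contraction_finite:
  fixes f :: "'b \<Rightarrow> 'c::{banach, second_countable_topology}"
  assumes f: "f \<in> Lp_functions mixture p" and "1 \<le> p" and "p \<noteq> \<infinity>"
  shows "kernel_integral \<mu> f \<in> Lp_functions \<nu> p \<and>
    Lp_norm \<nu> p (kernel_integral \<mu> f) \<le> Lp_norm mixture p f"
proof -
  interpret mix: finite_measure mixture by (rule finite_measure_mixture)
  define r where "r = enn2real p"
  have "1 \<le> r"
    using \<open>1 \<le> p\<close> \<open>p \<noteq> \<infinity>\<close> unfolding r_def by (cases p) auto
  have f_Y [measurable]: "f \<in> borel_measurable Y"
    and int_r: "integrable mixture (\<lambda>y. norm (f y) powr r)"
    using f \<open>p \<noteq> \<infinity>\<close> by (auto simp: Lp_functions_def r_def)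
  have int: "integrable mixture f"
    using f \<open>1 \<le> p\<close> by (rule mix.integrable_Lp_functions)
  define I where "I = (\<integral>y. norm (f y) powr r \<partial>mixture)"
  \<comment> \<open>Jensen's inequality at \<open>x\<close> asks that both \<open>f\<close> and its
    \<open>r\<close>-th power norm be integrable for \<open>\<mu> x\<close>; each excludes a null
    set of \<open>x\<close>.\<close>
  have "AE x in \<nu>. ennreal (norm (kernel_integral \<mu> f x) powr r) \<le>
      (\<integral>\<^sup>+y. norm (f y) powr r \<partial>\<mu> x)"
    using AE_integrable_kernel[OF int] AE_integrable_kernel[OF int_r] AE_space
  proof eventually_elim
    case (elim x)
    interpret prob_space "\<mu> x" using elim by (intro prob_space_kernel)
    show ?case
      using norm_integral_powr_le[OF \<open>1 \<le> r\<close>] elim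
      by (simp add: kernel_integral_def nn_integral_eq_integral ennreal_leI)
  qed
  then have "(\<integral>\<^sup>+x. norm (kernel_integral \<mu> f x) powr r \<partial>\<nu>) \<le>
      (\<integral>\<^sup>+x. \<integral>\<^sup>+y. norm (f y) powr r \<partial>\<mu> x \<partial>\<nu>)"
    by (rule nn_integral_mono_AE)
  also have "\<dots> = ennreal I"
    using int_r by (simp add: I_def nn_integral_eq_integral flip: nn_integral_mixture)
  finally have le: "(\<integral>\<^sup>+x. norm (kernel_integral \<mu> f x) powr r \<partial>\<nu>) \<le> ennreal I" .
  \<comment> \<open>The finite bound on the nonnegative integral yields integrability, which permits
    the return to real-valued integrals.\<close>
  then have int_K: "integrable \<nu> (\<lambda>x. norm (kernel_integral \<mu> f x) powr r)"
    by (intro integrableI_bounded) (auto intro: le_less_trans)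
  have "0 \<le> I"
    unfolding I_def by simp
  then have "(\<integral>x. norm (kernel_integral \<mu> f x) powr r \<partial>\<nu>) \<le> I"
    using le int_K by (simp add: nn_integral_eq_integral)
  then have "(\<integral>x. norm (kernel_integral \<mu> f x) powr r \<partial>\<nu>) powr (1 / r) \<le> I powr (1 / r)"
    using \<open>1 \<le> r\<close> by (intro powr_mono2) auto
  then show ?thesis
    using int_K \<open>p \<noteq> \<infinity>\<close> by (simp add: Lp_functions_def Lp_norm_def r_def I_def)
qed

lemma kernel_integral_contraction:
  fixes f :: "'b \<Rightarrow> 'c::{banach, second_countable_topology}"
  assumes "f \<in> Lp_functions mixture p" and "1 \<le> p"
  shows "kernel_integral \<mu> f \<in> Lp_functions \<nu> p"
    and "Lp_norm \<nu> p (kernel_integral \<mu> f) \<le> Lp_norm mixture p f"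
  using assms kernel_integral_contraction_infinity kernel_integral_contraction_finite
  by (cases "p = \<infinity>"; blast)+

end

section \<open>Passage from functions to classes\<close>

theorem theorem2p1:
  fixes X \<nu>\<^sub>1 :: "'a measure" and Y \<nu>\<^sub>2 :: "'b measure"
    and \<mu> :: "'a \<Rightarrow> 'b measure"
    and p :: ennreal
    and A :: "('b \<Rightarrow> 'c::{real_normed_field, banach, second_countable_topology}) set \<Rightarrow> ('a \<Rightarrow> 'c) set"
  assumes "sets \<nu>\<^sub>1 = sets X" and "finite_measure \<nu>\<^sub>1"
    and "markov_kernel X Y \<mu>"
    and "\<nu>\<^sub>2 = kernel_mixture \<nu>\<^sub>1 Y \<mu>"
    and "1 \<le> p"
    and "A = kernel_operator \<nu>\<^sub>1 \<mu>"
  shows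
    "(sets \<nu>\<^sub>2 = sets Y \<and> finite_measure \<nu>\<^sub>2 \<and>
      (\<forall>E\<in>sets Y. emeasure \<nu>\<^sub>2 E = (\<integral>\<^sup>+x. emeasure (\<mu> x) E \<partial>\<nu>\<^sub>1))) \<and>
     (\<forall>F\<in>Lp_space \<nu>\<^sub>2 p.
        (\<forall>f\<in>F. AE x in \<nu>\<^sub>1. integrable (\<mu> x) f) \<and>
        (\<forall>f\<in>F. \<forall>g\<in>F. AE x in \<nu>\<^sub>1. kernel_integral \<mu> f x = kernel_integral \<mu> g x) \<and>
        A F \<in> ae_classes \<nu>\<^sub>1 \<and>
        (\<forall>f\<in>F. kernel_integral \<mu> f \<in> A F)) \<and>
     (\<forall>F\<in>Lp_space \<nu>\<^sub>2 p.
        A F \<in> Lp_space \<nu>\<^sub>1 p \<and>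
        Lp_class_norm \<nu>\<^sub>1 p (A F) \<le> Lp_class_norm \<nu>\<^sub>2 p F) \<and>
     (\<forall>F\<in>Lp_space \<nu>\<^sub>2 p. \<forall>G\<in>Lp_space \<nu>\<^sub>2 p. \<forall>a b.
        A (ae_lincomb \<nu>\<^sub>2 a F b G) = ae_lincomb \<nu>\<^sub>1 a (A F) b (A G))"
proof -
  \<comment> \<open>\<open>markov_kernel\<close> depends on its first argument only through the
    space and the measurable sets, which \<open>X\<close> and \<open>\<nu>\<^sub>1\<close>
    share.\<close>
  have "markov_kernel \<nu>\<^sub>1 Y \<mu>"
    using assms(3) sets_eq_imp_space_eq[OF assms(1)] measurable_cong_sets[OF assms(1) refl]
    unfolding markov_kernel_def by blast
  then interpret markov_mixture \<nu>\<^sub>1 Y \<mu>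
    using assms(2) by (simp add: markov_mixture_def markov_mixture_axioms_def)
  interpret mix: finite_measure \<nu>\<^sub>2
    unfolding assms(4) by (rule finite_measure_mixture)
  have sets_\<nu>\<^sub>2: "sets \<nu>\<^sub>2 = sets Y"
    by (simp add: assms(4))
  have A_class: "A (ae_class \<nu>\<^sub>2 f) = ae_class \<nu>\<^sub>1 (kernel_integral \<mu> f)"
    if "f \<in> borel_measurable \<nu>\<^sub>2" for f
    using that by (simp add: assms(4,6) kernel_operator_ae_class)
  have Lp_meas: "f \<in> borel_measurable M" if "f \<in> Lp_functions M p" for M and f :: "'d \<Rightarrow> 'c"
    using that by (simp add: Lp_functions_def)
  have K_meas: "kernel_integral \<mu> f \<in> borel_measurable \<nu>\<^sub>1" if "f \<in> borel_measurable \<nu>\<^sub>2"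
    for f :: "'b \<Rightarrow> 'c"
    using that by (simp add: assms(4) borel_measurable_kernel_integral)
  have members: "(\<forall>f\<in>F. AE x in \<nu>\<^sub>1. integrable (\<mu> x) f) \<and>
        (\<forall>f\<in>F. \<forall>g\<in>F. AE x in \<nu>\<^sub>1. kernel_integral \<mu> f x = kernel_integral \<mu> g x) \<and>
        A F \<in> ae_classes \<nu>\<^sub>1 \<and>
        (\<forall>f\<in>F. kernel_integral \<mu> f \<in> A F)"
    if F: "F \<in> Lp_space \<nu>\<^sub>2 p" for F
  proof -
    obtain h where h: "h \<in> Lp_functions \<nu>\<^sub>2 p" and F_eq: "F = ae_class \<nu>\<^sub>2 h"
      using F by (auto simp: Lp_space_def)
    have F_meas: "f \<in> borel_measurable \<nu>\<^sub>2" and F_AE: "AE y in \<nu>\<^sub>2. f y = h y" if "f \<in> F" for f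
      using that by (auto simp: F_eq ae_class_def)
    \<comment> \<open>Comparison with the fixed representative \<open>h\<close> gives both the
      independence of the choice and the membership in \<open>A F\<close>.\<close>
    have K_eq: "AE x in \<nu>\<^sub>1. kernel_integral \<mu> f x = kernel_integral \<mu> h x" if "f \<in> F" for f
      using F_meas[OF that] F_AE[OF that] Lp_meas[OF h]
      unfolding assms(4) by (intro kernel_integral_cong_AE) simp_all
    have "AE x in \<nu>\<^sub>1. integrable (\<mu> x) f" if "f \<in> F" for f
    proof -
      have "f \<in> Lp_functions \<nu>\<^sub>2 p"
        using h F_meas[OF that] F_AE[OF that] by (rule Lp_functions_cong_AE)
      then have "integrable \<nu>\<^sub>2 f"
        using assms(5) by (rule mix.integrable_Lp_functions)
      then show ?thesis
        unfolding assms(4) by (rule AE_integrable_kernel)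
    qed
    moreover have "AE x in \<nu>\<^sub>1. kernel_integral \<mu> f x = kernel_integral \<mu> g x"
      if "f \<in> F" "g \<in> F" for f g
      using K_eq[OF that(1)] K_eq[OF that(2)] by eventually_elim simp
    moreover have "A F \<in> ae_classes \<nu>\<^sub>1"
      unfolding F_eq A_class[OF Lp_meas[OF h]] ae_classes_def
      by (intro imageI K_meas Lp_meas h)
    moreover have "kernel_integral \<mu> f \<in> A F" if "f \<in> F" for f
      using K_eq[OF that] K_meas[OF F_meas[OF that]]
      unfolding F_eq A_class[OF Lp_meas[OF h]] by (simp add: ae_class_def)
    ultimately show ?thesis by blast
  qed
  have contraction: "A F \<in> Lp_space \<nu>\<^sub>1 p \<and> Lp_class_norm \<nu>\<^sub>1 p (A F) \<le> Lp_class_norm \<nu>\<^sub>2 p F"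
    if F: "F \<in> Lp_space \<nu>\<^sub>2 p" for F
  proof -
    obtain h where h: "h \<in> Lp_functions \<nu>\<^sub>2 p" and F_eq: "F = ae_class \<nu>\<^sub>2 h"
      using F by (auto simp: Lp_space_def)
    have "kernel_integral \<mu> h \<in> Lp_functions \<nu>\<^sub>1 p"
      and "Lp_norm \<nu>\<^sub>1 p (kernel_integral \<mu> h) \<le> Lp_norm \<nu>\<^sub>2 p h"
      using kernel_integral_contraction[OF _ assms(5)] h by (auto simp: assms(4))
    then show ?thesis
      using Lp_meas[OF h] K_meas
      by (simp add: F_eq A_class Lp_class_norm_ae_class Lp_space_def)
  qed
  have linear: "A (ae_lincomb \<nu>\<^sub>2 a F b G) = ae_lincomb \<nu>\<^sub>1 a (A F) b (A G)"
    if F: "F \<in> Lp_space \<nu>\<^sub>2 p" and G: "G \<in> Lp_space \<nu>\<^sub>2 p" for F G a b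
  proof -
    obtain f g where f: "f \<in> Lp_functions \<nu>\<^sub>2 p" and F_eq: "F = ae_class \<nu>\<^sub>2 f"
      and g: "g \<in> Lp_functions \<nu>\<^sub>2 p" and G_eq: "G = ae_class \<nu>\<^sub>2 g"
      using F G by (auto simp: Lp_space_def)
    note [measurable] = Lp_meas[OF f] Lp_meas[OF g]
    have "A (ae_lincomb \<nu>\<^sub>2 a F b G) = ae_class \<nu>\<^sub>1 (kernel_integral \<mu> (\<lambda>y. a * f y + b * g y))"
      by (simp add: F_eq G_eq ae_lincomb_ae_class A_class)
    \<comment> \<open>Both representatives are integrable for the finite measure
      \<open>\<nu>\<^sub>2\<close>, so the kernel integral is linear at almost every
      \<open>x\<close>.\<close>
    also have "\<dots> = ae_class \<nu>\<^sub>1 (\<lambda>x. a * kernel_integral \<mu> f x + b * kernel_integral \<mu> g x)"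
      using mix.integrable_Lp_functions[OF f assms(5)] mix.integrable_Lp_functions[OF g assms(5)]
      by (intro ae_class_eqI kernel_integral_lincomb) (simp_all add: assms(4))
    also have "\<dots> = ae_lincomb \<nu>\<^sub>1 a (A F) b (A G)"
      by (simp add: F_eq G_eq ae_lincomb_ae_class A_class K_meas)
    finally show ?thesis .
  qed
  show ?thesis
    using sets_\<nu>\<^sub>2 mix.finite_measure_axioms emeasure_mixture members contraction linear
    by (auto simp: assms(4))
qed

end
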